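(* Let $0<x_1<x_2<\cdots$ be an infinite sequence of integers (trap positions on $\mathbb{Z}_{>0}$). If $\liminf\limits_{n\to\infty}\dfrac{x_{n+1}}{x_n^2}>1$, then the model with traps $(x_k)_{k\ge1}$ is critical.
   Context: The model is the trapped random walk on the half-line: with $D_+=\{x_k\}_{k\ge1}$, it is the Markov chain on $\{0,1,2,\dots\}\cup\{s\}$ where $s$ (the sink) and $0$ are absorbing, from $x\ge 1$ with $x\notin D_+$ the walk moves to $x-1$ or $x+1$ with probability $1/2$ each, and from $x\in D_+$ it moves to $x-1$, $x+1$ or $s$ with probability $1/3$ each. Let $T$ be the first time the walk is in $\{0,s\}$, and let $\mathbb{E}_x(T)\in[0,\infty]$ be its expectation for the walk started at $x$. The model is called critical if $\mathbb{E}_1(T)=\infty$ and non-critical if $\mathbb{E}_1(T)<\infty$ (the finiteness of $\mathbb{E}_x(T)$ does not depend on the starting point $x\ge 1$). *)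

theory Defs
  imports "HOL-Probability.Probability"
begin

section \<open>The trapped walk as a Markov kernel\<close>

datatype state = Site nat | Sink

fun step :: "nat set \<Rightarrow> state \<Rightarrow> state pmf" where
  "step D Sink = return_pmf Sink"
| "step D (Site 0) = return_pmf (Site 0)"
| "step D (Site (Suc k)) =
    (if Suc k \<in> D then pmf_of_set {Site k, Site (k + 2), Sink}
     else pmf_of_set {Site k, Site (k + 2)})"

section \<open>The law of the walk on trajectory space\<close>

definition walk_kernel :: "nat set \<Rightarrow> nat \<Rightarrow> nat \<Rightarrow> (nat \<Rightarrow> state) \<Rightarrow> state measure" where
  "walk_kernel D x n \<omega> =
    (case n of 0 \<Rightarrow> measure_pmf (return_pmf (Site x)) | Suc m \<Rightarrow> measure_pmf (step D (\<omega> m)))"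

text \<open>The Ionescu-Tulcea measure on \<^typ>\<open>nat \<Rightarrow> state\<close> with these one-step kernels; the locale
  constants are spelled out because the locale is interpreted only below.
  Lemma \<open>emeasure_walk_law_cylinder\<close> gives the finite-dimensional distributions, which
  characterise the Markov chain with transition probabilities \<^const>\<open>step\<close> started at \<open>x\<close>.\<close>

definition walk_law :: "nat set \<Rightarrow> nat \<Rightarrow> (nat \<Rightarrow> state) measure" where
  "walk_law D x =
    projective_family.lim UNIV
      (Ionescu_Tulcea.CI (walk_kernel D x) (\<lambda>_. count_space UNIV)) (\<lambda>_. count_space UNIV)"

text \<open>The infimum is \<open>\<infinity>\<close> if the walk is never absorbed.\<close>

definition absorption_time :: "(nat \<Rightarrow> state) \<Rightarrow> enat" where
  "absorption_time \<omega> = Inf (enat ` {n. \<omega> n \<in> {Site 0, Sink}})"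

definition expected_absorption_time :: "nat set \<Rightarrow> nat \<Rightarrow> ennreal" where
  "expected_absorption_time D x = (\<integral>\<^sup>+\<omega>. ennreal_of_enat (absorption_time \<omega>) \<partial>walk_law D x)"

definition critical :: "nat set \<Rightarrow> bool" where
  "critical D \<longleftrightarrow> expected_absorption_time D 1 = \<infinity>"

section \<open>Sanity of the construction\<close>

lemma pmf_step_free:
  assumes "Suc k \<notin> D"
  shows "pmf (step D (Site (Suc k))) (Site k) = 1/2"
    and "pmf (step D (Site (Suc k))) (Site (k + 2)) = 1/2"
  using assms by simp_all

lemma pmf_step_trap:
  assumes "Suc k \<in> D"
  shows "pmf (step D (Site (Suc k))) (Site k) = 1/3"
    and "pmf (step D (Site (Suc k))) (Site (k + 2)) = 1/3"
    and "pmf (step D (Site (Suc k))) Sink = 1/3"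
  using assms by simp_all

interpretation walk: Ionescu_Tulcea "walk_kernel D x" "\<lambda>_. count_space UNIV" for D x
proof (rule Ionescu_Tulcea.intro)
  show "walk_kernel D x n \<in> measurable (PiM {0..<n} (\<lambda>_. count_space UNIV))
      (subprob_algebra (count_space UNIV))" for n
  proof (cases n)
    case (Suc m)
    have "(\<lambda>\<omega>. \<omega> m) \<in> measurable (PiM {0..<n} (\<lambda>_. count_space UNIV)) (count_space UNIV)"
      using Suc by (intro measurable_component_singleton) auto
    moreover have "(\<lambda>s. measure_pmf (step D s)) \<in>
        measurable (count_space UNIV) (subprob_algebra (count_space UNIV))"
      by (auto intro: measure_pmf_in_subprob_algebra)
    ultimately show ?thesis
      unfolding walk_kernel_def Suc by (simp add: measurable_compose[of _ _ "count_space UNIV"])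
  qed (auto simp: walk_kernel_def[abs_def] intro!: measurable_const measure_pmf_in_subprob_algebra)
  show "prob_space (walk_kernel D x n \<omega>)" for n \<omega>
    by (cases n) (auto simp: walk_kernel_def prob_space_measure_pmf)
qed

lemma prob_space_walk_law: "prob_space (walk_law D x)"
proof
  have "space (walk_law D x) = prod_emb UNIV (\<lambda>_. count_space UNIV) {} (space (PiM {} (\<lambda>_. count_space UNIV)))"
    unfolding walk_law_def by (auto simp: walk.PF.space_lim space_PiM prod_emb_def restrict_def)
  then have "emeasure (walk_law D x) (space (walk_law D x)) =
      emeasure (walk.CI D x {}) (space (PiM {} (\<lambda>_. count_space UNIV)))"
    by (simp only: walk_law_def walk.lim[OF finite.emptyI sets.top])
  also have "\<dots> = 1"
    using prob_space.emeasure_space_1[OF walk.PF.prob_space_P[of "{}" D x]]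
    by (simp add: walk.PF.space_P)
  finally show "emeasure (walk_law D x) (space (walk_law D x)) = 1" .
qed

lemma sets_walk_law: "sets (walk_law D x) = sets (PiM UNIV (\<lambda>_. count_space UNIV))"
  unfolding walk_law_def by (rule walk.PF.sets_lim)

lemma singleton_in_sets_PiM:
  "{restrict p {0..<n}} \<in> sets (PiM {0..<n} (\<lambda>_. count_space UNIV))" for p :: "nat \<Rightarrow> state"
proof -
  have "{restrict p {0..<n}} = PiE {0..<n} (\<lambda>i. {restrict p {0..<n} i})"
    by (subst PiE_singleton) auto
  also have "\<dots> \<in> sets (PiM {0..<n} (\<lambda>_. count_space UNIV))"
    by (intro sets_PiM_I_finite) auto
  finally show ?thesis .
qed

lemma emeasure_C_singleton:
  "emeasure (walk.C D x 0 n (\<lambda>_. undefined)) {restrict p {0..<n}}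
    = (\<Prod>i<n. emeasure (walk_kernel D x i p) {p i})"
proof (induction n)
  case 0
  show ?case using singleton_in_sets_PiM[of p 0] by (simp add: restrict_def)
next
  case (Suc n)
  let ?C = "walk.C D x 0 n (\<lambda>_. undefined)"
  let ?q = "restrict p {0..<Suc n}"
  have sp: "space ?C = space (PiM {0..<n} (\<lambda>_. count_space UNIV))"
    by (subst walk.space_C) (auto simp: space_PiM)
  have stp: "emeasure (walk.eP D x n \<omega>) {?q} =
      emeasure (walk_kernel D x n p) {p n} * indicator {restrict p {0..<n}} \<omega>"
    if w: "\<omega> \<in> space (PiM {0..<n} (\<lambda>_. count_space UNIV))" for \<omega>
  proof -
    have ext: "\<omega> \<in> extensional {0..<n}" using w by (auto simp: space_PiM PiE_iff)
    have eq: "fun_upd \<omega> n y = ?q \<longleftrightarrow> \<omega> = restrict p {0..<n} \<and> y = p n" for y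
    proof
      assume *: "fun_upd \<omega> n y = ?q"
      have "\<omega> i = restrict p {0..<n} i" for i
        using fun_cong[OF *, of i] ext by (cases "i < n") (auto simp: extensional_def split: if_splits)
      with fun_cong[OF *, of n] show "\<omega> = restrict p {0..<n} \<and> y = p n" by auto
    qed (auto simp: fun_eq_iff)
    have ker: "walk_kernel D x n (restrict p {0..<n}) = walk_kernel D x n p"
      by (cases n) (auto simp: walk_kernel_def)
    have "emeasure (walk.eP D x n \<omega>) {?q} = emeasure (walk_kernel D x n \<omega>) {y. fun_upd \<omega> n y = ?q}"
      using w singleton_in_sets_PiM[of p "Suc n"]
      by (subst walk.emeasure_eP) (auto intro!: arg_cong[where f="emeasure _"])
    also have "\<dots> = emeasure (walk_kernel D x n p) {p n} * indicator {restrict p {0..<n}} \<omega>"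
      unfolding eq by (cases "\<omega> = restrict p {0..<n}") (auto simp: ker)
    finally show ?thesis .
  qed
  have "emeasure (walk.C D x 0 (Suc n) (\<lambda>_. undefined)) {?q} =
      (\<integral>\<^sup>+\<omega>. emeasure (walk.eP D x n \<omega>) {?q} \<partial>?C)"
    unfolding walk.C.simps add_0
    using singleton_in_sets_PiM[of p "Suc n"] walk.measurable_eP[of D x n]
    by (subst emeasure_bind[where N="PiM {0..<Suc n} (\<lambda>_. count_space UNIV)"])
       (auto simp: sp measurable_cong_sets[OF walk.sets_C refl] space_PiM)
  also have "\<dots> = (\<integral>\<^sup>+\<omega>. emeasure (walk_kernel D x n p) {p n} * indicator {restrict p {0..<n}} \<omega> \<partial>?C)"
    by (intro nn_integral_cong stp) (simp add: sp)
  also have "\<dots> = emeasure (walk_kernel D x n p) {p n} * emeasure ?C {restrict p {0..<n}}"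
    using singleton_in_sets_PiM[of p n]
    by (subst nn_integral_cmult_indicator) (auto simp: walk.sets_C space_PiM)
  finally show ?case using Suc by (simp add: mult.commute del: walk.C.simps restrict_apply cong del: restrict_cong)
qed

lemma emeasure_walk_law_cylinder:
  "emeasure (walk_law D x) {\<omega>. \<forall>i\<le>n. \<omega> i = p i} =
    (if p 0 = Site x then \<Prod>i<n. ennreal (pmf (step D (p i)) (p (Suc i))) else 0)"
proof -
  let ?J = "{0..<Suc n}" and ?M = "\<lambda>_. count_space UNIV :: state measure"
  have "{\<omega>. \<forall>i\<le>n. \<omega> i = p i} = prod_emb UNIV ?M ?J {restrict p ?J}"
    by (simp add: prod_emb_def space_PiM set_eq_iff fun_eq_iff restrict_def less_Suc_eq_le)
  then have "emeasure (walk_law D x) {\<omega>. \<forall>i\<le>n. \<omega> i = p i} = emeasure (walk.CI D x ?J) {restrict p ?J}"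
    unfolding walk_law_def using singleton_in_sets_PiM[of p "Suc n"] by (simp add: walk.lim)
  also have "\<dots> = emeasure (walk.C D x 0 (Suc n) (\<lambda>_. undefined)) {restrict p ?J}"
    using singleton_in_sets_PiM[of p "Suc n"]
    by (subst walk.emeasure_CI[of _ "Suc n"])
       (auto simp: space_PiM prod_emb_id simp del: walk.C.simps)
  also have "\<dots> = emeasure (walk_kernel D x 0 p) {p 0} *
      (\<Prod>i<n. emeasure (walk_kernel D x (Suc i) p) {p (Suc i)})"
    unfolding emeasure_C_singleton by (rule prod.lessThan_Suc_shift)
  also have "\<dots> = (if p 0 = Site x then \<Prod>i<n. ennreal (pmf (step D (p i)) (p (Suc i))) else 0)"
    by (auto simp: walk_kernel_def emeasure_pmf_single)
  finally show ?thesis .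
qed

lemma borel_measurable_absorption_time:
  "(\<lambda>\<omega>. ennreal_of_enat (absorption_time \<omega>)) \<in> borel_measurable (walk_law D x)"
proof -
  have "ennreal_of_enat (absorption_time \<omega>) =
      (INF n. if \<omega> n \<in> {Site 0, Sink} then of_nat n else \<infinity>)" (is "_ = ?R") for \<omega>
  proof (cases "\<exists>n. \<omega> n \<in> {Site 0, Sink}")
    case True
    define m where "m = (LEAST n. \<omega> n \<in> {Site 0, Sink})"
    have m: "\<omega> m \<in> {Site 0, Sink}" unfolding m_def using True by (rule LeastI_ex)
    have le: "m \<le> n" if "\<omega> n \<in> {Site 0, Sink}" for n
      unfolding m_def using that by (rule Least_le)
    have "absorption_time \<omega> = enat m"
      unfolding absorption_time_def by (rule Inf_eqI) (use m le in auto)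
    moreover have "?R = of_nat m"
    proof (intro antisym INF_greatest)
      show "?R \<le> of_nat m" by (rule INF_lower2[of m]) (use m in auto)
    qed (use le in auto)
    ultimately show ?thesis by simp
  next
    case False
    then show ?thesis by (simp add: absorption_time_def top_enat_def)
  qed
  moreover have "(\<lambda>\<omega>. INF n. if \<omega> n \<in> {Site 0, Sink} then of_nat n else \<infinity> :: ennreal)
      \<in> borel_measurable (PiM UNIV (\<lambda>_. count_space UNIV))"
    by (intro borel_measurable_INF measurable_compose[OF measurable_component_singleton]) auto
  ultimately show ?thesis
    by (simp add: measurable_cong_sets[OF sets_walk_law refl])
qed

end

theory Submission
  imports Defs
begin

text \<open>Let \<open>h\<close> be the harmonic function of the walk killed at the traps, with \<open>h 0 = 0\<close> and \<open>h 1 = 1\<close>.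
  The walk started at \<open>1\<close> reaches the trap \<open>x\<^sub>n\<close> with probability \<open>1 / h (x\<^sub>n)\<close>, and the expected time
  it then spends in the gap up to \<open>x\<^sub>n\<^sub>+\<^sub>1\<close> is of the order of the length of the gap. So the expected
  absorption time is at least a constant times \<open>x\<^sub>n\<^sub>+\<^sub>1 / h (x\<^sub>n)\<close>. Since \<open>h\<close> is affine between traps and
  its slope increases at \<open>x\<^sub>n\<close> by \<open>h (x\<^sub>n)\<close>, the quotient \<open>h (x\<^sub>n\<^sub>+\<^sub>1) / h (x\<^sub>n)\<close> is at most
  \<open>(1 + o(1)) x\<^sub>n\<^sub>+\<^sub>1\<close>; if \<open>x\<^sub>n\<^sub>+\<^sub>1 \<ge> a x\<^sub>n\<^sup>2\<close> with \<open>a > 1\<close>, the lower bounds therefore grow geometrically.\<close>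

section \<open>The Markov property and a lower bound for the expected absorption time\<close>

abbreviation alive :: "state \<Rightarrow> bool" where
  "alive s \<equiv> s \<notin> {Site 0, Sink}"

text \<open>An \<open>ennreal\<close>-valued indicator that absorption comes after time
  \<open>n\<close>: it can serve as a weight in \<open>nn_integral\<close>, and its integral is a
  tail probability of the absorption time.\<close>

definition survives :: "nat \<Rightarrow> (nat \<Rightarrow> state) \<Rightarrow> ennreal" where
  "survives n \<omega> = (if \<forall>i\<le>n. alive (\<omega> i) then 1 else 0)"

text \<open>The marginal of the projective limit on \<open>{0..<n}\<close> is
  \<open>walk.CI\<close>, a restriction of the composed kernel \<open>walk.C\<close>. In
  \<open>walk.C\<close> the last step can be split off.\<close>

lemma nn_integral_walk_law_prefix:
  assumes F: "F \<in> borel_measurable (PiM {0..<n} (\<lambda>_. count_space UNIV))"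
  shows "(\<integral>\<^sup>+\<omega>. F (restrict \<omega> {0..<n}) \<partial>walk_law D x) = (\<integral>\<^sup>+\<omega>. F \<omega> \<partial>walk.C D x 0 n (\<lambda>_. undefined))"
proof -
  let ?M = "\<lambda>_. count_space UNIV :: state measure"
  let ?J = "{0..<n}"
  have r: "(\<lambda>\<omega>. restrict \<omega> ?J) \<in> measurable (walk_law D x) (PiM ?J ?M)"
    by (auto simp: measurable_cong_sets[OF sets_walk_law refl] intro!: measurable_restrict)
  \<comment> \<open>\<open>walk.CI\<close> composes kernels up to the least bound of its index set;
    for an initial segment this adds no extra step.\<close>
  have up: "walk.up_to ?J = n"
    by (rule antisym) (simp_all add: walk.up_to_iff_Ico, use walk.up_to[of ?J] in auto)
  have "(\<integral>\<^sup>+\<omega>. F (restrict \<omega> ?J) \<partial>walk_law D x) = (\<integral>\<^sup>+\<omega>. F \<omega> \<partial>distr (walk_law D x) (PiM ?J ?M) (\<lambda>\<omega>. restrict \<omega> ?J))"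
    by (rule nn_integral_distr[symmetric, OF r]) (use F in simp)
  also have "distr (walk_law D x) (PiM ?J ?M) (\<lambda>\<omega>. restrict \<omega> ?J) = walk.CI D x ?J"
    unfolding walk_law_def by (rule walk.distr_lim) simp
  also have "(\<integral>\<^sup>+\<omega>. F \<omega> \<partial>walk.CI D x ?J) = (\<integral>\<^sup>+\<omega>. F (restrict \<omega> ?J) \<partial>walk.C D x 0 n (\<lambda>_. undefined))"
    unfolding walk.CI_def up
    by (rule nn_integral_distr)
      (auto simp: F measurable_cong_sets[OF walk.sets_C refl] space_PiM intro!: measurable_restrict)
  also have "\<dots> = (\<integral>\<^sup>+\<omega>. F \<omega> \<partial>walk.C D x 0 n (\<lambda>_. undefined))"
    by (rule nn_integral_cong) (auto simp: walk.space_C space_PiM)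
  finally show ?thesis .
qed

text \<open>On finite prefixes the last kernel \<open>walk.eP\<close> appends one coordinate with
  law \<open>step D (\<omega> n)\<close>. The weight \<open>F\<close> sees only the past, so it is
  constant in that inner integral.\<close>

lemma walk_law_Markov:
  assumes F: "F \<in> borel_measurable (PiM {0..<Suc n} (\<lambda>_. count_space UNIV))"
  shows "(\<integral>\<^sup>+\<omega>. g (\<omega> (Suc n)) * F (restrict \<omega> {0..<Suc n}) \<partial>walk_law D x) =
    (\<integral>\<^sup>+\<omega>. (\<integral>\<^sup>+t. g t \<partial>step D (\<omega> n)) * F (restrict \<omega> {0..<Suc n}) \<partial>walk_law D x)"
proof -
  let ?M = "\<lambda>_. count_space UNIV :: state measure"
  let ?I = "{0..<Suc n}" and ?J = "{0..<Suc (Suc n)}"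
  let ?C = "\<lambda>m. walk.C D x 0 m (\<lambda>_. undefined)"
  let ?G = "\<lambda>\<omega>. g (\<omega> (Suc n)) * F (restrict \<omega> ?I)"
  let ?H = "\<lambda>\<omega>. (\<integral>\<^sup>+t. g t \<partial>step D (\<omega> n)) * F (restrict \<omega> ?I)"
  have G: "?G \<in> borel_measurable (PiM ?J ?M)"
    by (intro borel_measurable_times_ennreal measurable_compose[OF measurable_component_singleton]
        measurable_compose[OF measurable_restrict F] measurable_component_singleton) auto
  have H: "?H \<in> borel_measurable (PiM ?I ?M)"
    by (intro borel_measurable_times_ennreal measurable_compose[OF _ F] measurable_restrict
      measurable_compose[OF measurable_component_singleton,
          where g = "\<lambda>s. \<integral>\<^sup>+t. g t \<partial>step D s"]) auto
  have "(\<integral>\<^sup>+\<omega>. ?G \<omega> \<partial>walk_law D x) = (\<integral>\<^sup>+\<omega>. ?G (restrict \<omega> ?J) \<partial>walk_law D x)"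
    by (simp add: restrict_restrict Int_absorb1 Int_absorb2 ivl_subset cong: restrict_cong)
  also have "\<dots> = (\<integral>\<^sup>+\<omega>. ?G \<omega> \<partial>?C (Suc (Suc n)))"
    by (rule nn_integral_walk_law_prefix[OF G])
  also have "\<dots> = (\<integral>\<^sup>+\<omega>. \<integral>\<^sup>+\<omega>'. ?G \<omega>' \<partial>walk.eP D x (Suc n) \<omega> \<partial>?C (Suc n))"
    unfolding walk.C.simps(2)[of _ _ _ "Suc n"] add_0
    by (rule nn_integral_bind[OF G])
      (use walk.measurable_eP[of D x "Suc n"] in
        \<open>simp add: measurable_cong_sets[OF walk.sets_C refl] space_PiM del: walk.C.simps\<close>)
  also have "\<dots> = (\<integral>\<^sup>+\<omega>. ?H \<omega> \<partial>?C (Suc n))"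
  proof (rule nn_integral_cong)
    fix \<omega> assume "\<omega> \<in> space (?C (Suc n))"
    then have w: "\<omega> \<in> space (PiM ?I ?M)"
      by (subst (asm) walk.space_C) (auto simp: space_PiM)
    have "(\<integral>\<^sup>+\<omega>'. ?G \<omega>' \<partial>walk.eP D x (Suc n) \<omega>) =
        (\<integral>\<^sup>+t. ?G (fun_upd \<omega> (Suc n) t) \<partial>walk_kernel D x (Suc n) \<omega>)"
      by (rule walk.nn_integral_eP[OF w G])
    also have "\<dots> = (\<integral>\<^sup>+t. g t * F (restrict \<omega> ?I) \<partial>step D (\<omega> n))"
      by (simp add: walk_kernel_def restrict_def fun_upd_def cong: if_cong)
    also have "\<dots> = ?H \<omega>" by (simp add: nn_integral_multc)
    finally show "(\<integral>\<^sup>+\<omega>'. ?G \<omega>' \<partial>walk.eP D x (Suc n) \<omega>) = ?H \<omega>" .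
  qed
  also have "\<dots> = (\<integral>\<^sup>+\<omega>. ?H (restrict \<omega> ?I) \<partial>walk_law D x)"
    by (rule nn_integral_walk_law_prefix[OF H, symmetric])
  also have "\<dots> = (\<integral>\<^sup>+\<omega>. ?H \<omega> \<partial>walk_law D x)"
    by simp
  finally show ?thesis .
qed

section \<open>Survival probabilities and the expected absorption time\<close>

lemma survives_restrict: "survives n (restrict \<omega> {0..<Suc n}) = survives n \<omega>"
  by (simp add: survives_def)

lemma measurable_survives:
  assumes "{0..<Suc n} \<subseteq> I"
  shows "survives n \<in> borel_measurable (PiM I (\<lambda>_. count_space UNIV))"
proof -
  have "survives n \<omega> = (\<Prod>i\<le>n. if alive (\<omega> i) then 1 else 0)" for \<omega>
    by (induction n) (auto simp: survives_def le_Suc_eq)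
  moreover have "(\<lambda>\<omega>. \<Prod>i\<le>n. if alive (\<omega> i) then 1 else 0 :: ennreal)
      \<in> borel_measurable (PiM I (\<lambda>_. count_space UNIV))"
  proof (rule borel_measurable_prod_ennreal)
    fix i assume "i \<in> {..n}"
    then have "i \<in> I" using assms by auto
    then show "(\<lambda>\<omega>. if alive (\<omega> i) then 1 else 0 :: ennreal)
        \<in> borel_measurable (PiM I (\<lambda>_. count_space UNIV))"
      by (rule measurable_compose[OF measurable_component_singleton]) simp
  qed
  ultimately show ?thesis by (simp cong: measurable_cong)
qed

lemma measurable_survives_walk_law: "survives n \<in> borel_measurable (walk_law D x)"
  by (subst measurable_cong_sets[OF sets_walk_law refl]) (rule measurable_survives, simp)

text \<open>\<open>survives n \<omega>\<close> is 1 exactly for the times before absorption, so the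
  sum counts those below \<open>N\<close>.\<close>

lemma sum_survives_le: "(\<Sum>n<N. survives n \<omega>) \<le> ennreal_of_enat (absorption_time \<omega>)"
proof (cases "\<exists>m. \<not> alive (\<omega> m)")
  case True
  define m where "m = (LEAST m. \<not> alive (\<omega> m))"
  have m: "\<not> alive (\<omega> m)" unfolding m_def using True by (rule LeastI_ex)
  have "absorption_time \<omega> = enat m"
    unfolding absorption_time_def by (rule Inf_eqI) (use m in \<open>auto simp: m_def intro: Least_le\<close>)
  moreover have "(\<Sum>n<N. survives n \<omega>) \<le> (\<Sum>n<N. if n < m then 1 else 0)"
    using m by (intro sum_mono) (auto simp: survives_def not_less)
  moreover have "(\<Sum>n<N. if n < m then 1 else 0 :: ennreal) = of_nat (card ({..<N} \<inter> {..<m}))"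
    by (simp add: sum.If_cases lessThan_def)
  moreover have "card ({..<N} \<inter> {..<m}) \<le> m"
    by (metis card_lessThan card_mono finite_lessThan inf_le2)
  ultimately show ?thesis by (metis ennreal_of_enat_enat of_nat_mono order_trans)
next
  case False
  then have "{n. \<omega> n \<in> {Site 0, Sink}} = {}" by auto
  then show ?thesis by (simp add: absorption_time_def top_enat_def)
qed

lemma sum_survival_prob_le:
  "(\<Sum>n<N. \<integral>\<^sup>+\<omega>. survives n \<omega> \<partial>walk_law D x) \<le> expected_absorption_time D x"
proof -
  have "(\<Sum>n<N. \<integral>\<^sup>+\<omega>. survives n \<omega> \<partial>walk_law D x) = (\<integral>\<^sup>+\<omega>. (\<Sum>n<N. survives n \<omega>) \<partial>walk_law D x)"
    by (intro nn_integral_sum[symmetric] measurable_survives_walk_law)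
  also have "\<dots> \<le> expected_absorption_time D x"
    unfolding expected_absorption_time_def by (intro nn_integral_mono sum_survives_le)
  finally show ?thesis .
qed

text \<open>The inequality for \<open>f\<close> is integrated over surviving paths, with
  \<open>survives n\<close> as the past in the Markov property. As \<open>f\<close> vanishes at
  absorbed states, the weight can be sharpened to \<open>survives (Suc n)\<close>, so the bound
  telescopes.\<close>

lemma nn_integral_survives_step:
  assumes f0: "\<And>s. \<not> alive s \<Longrightarrow> f s = 0"
    and f: "\<And>s. alive s \<Longrightarrow> f s \<le> 1 + (\<integral>\<^sup>+t. f t \<partial>step D s)"
  shows "(\<integral>\<^sup>+\<omega>. f (\<omega> n) * survives n \<omega> \<partial>walk_law D x) \<le>
    (\<integral>\<^sup>+\<omega>. survives n \<omega> \<partial>walk_law D x) +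
    (\<integral>\<^sup>+\<omega>. f (\<omega> (Suc n)) * survives (Suc n) \<omega> \<partial>walk_law D x)"
proof -
  have mp: "(\<lambda>\<omega>. \<integral>\<^sup>+t. f t \<partial>step D (\<omega> n)) \<in> borel_measurable (walk_law D x)"
    by (subst measurable_cong_sets[OF sets_walk_law refl])
      (rule measurable_compose[OF measurable_component_singleton,
          where g = "\<lambda>s. \<integral>\<^sup>+t. f t \<partial>step D s"], auto)
  have "(\<integral>\<^sup>+\<omega>. f (\<omega> n) * survives n \<omega> \<partial>walk_law D x) \<le>
      (\<integral>\<^sup>+\<omega>. survives n \<omega> + (\<integral>\<^sup>+t. f t \<partial>step D (\<omega> n)) * survives n \<omega> \<partial>walk_law D x)"
    by (rule nn_integral_mono) (use f in \<open>auto simp: survives_def\<close>)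
  also have "\<dots> = (\<integral>\<^sup>+\<omega>. survives n \<omega> \<partial>walk_law D x) +
      (\<integral>\<^sup>+\<omega>. (\<integral>\<^sup>+t. f t \<partial>step D (\<omega> n)) * survives n \<omega> \<partial>walk_law D x)"
    by (intro nn_integral_add borel_measurable_times_ennreal mp measurable_survives_walk_law)
  also have "(\<integral>\<^sup>+\<omega>. (\<integral>\<^sup>+t. f t \<partial>step D (\<omega> n)) * survives n \<omega> \<partial>walk_law D x) =
      (\<integral>\<^sup>+\<omega>. f (\<omega> (Suc n)) * survives n \<omega> \<partial>walk_law D x)"
    using walk_law_Markov[OF measurable_survives[OF order_refl], where g = f and n = n and D = D and x = x]
    by (simp only: survives_restrict)
  also have "\<dots> = (\<integral>\<^sup>+\<omega>. f (\<omega> (Suc n)) * survives (Suc n) \<omega> \<partial>walk_law D x)"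
    by (rule nn_integral_cong) (use f0 in \<open>auto simp: survives_def le_Suc_eq\<close>)
  finally show ?thesis .
qed

section \<open>Bounded subsolutions as lower bounds\<close>

lemma AE_walk_law_start: "AE \<omega> in walk_law D x. \<omega> 0 = Site x"
proof -
  interpret prob_space "walk_law D x" by (rule prob_space_walk_law)
  have "emeasure (walk_law D x) {\<omega>. \<omega> 0 = Site x} = 1"
    using emeasure_walk_law_cylinder[of D x 0 "\<lambda>_. Site x"] by simp
  \<comment> \<open>Sets that are not measurable have \<open>emeasure\<close> 0, so the value 1
    forces measurability.\<close>
  moreover from this have "{\<omega>. \<omega> 0 = Site x} \<in> events"
    by (metis emeasure_notin_sets zero_neq_one)
  ultimately show ?thesis
    using AE_in_set_eq_1[of "{\<omega>. \<omega> 0 = Site x}"] by (simp add: emeasure_eq_measure)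
qed

text \<open>Optional stopping by hand: telescoping bounds \<open>f (Site x)\<close> by the first
  \<open>N\<close> survival probabilities plus \<open>C\<close> times the next one. If the
  expectation is finite, this remainder tends to 0.\<close>

lemma expected_absorption_time_ge_subsolution:
  fixes f :: "state \<Rightarrow> real"
  assumes f0: "\<And>s. \<not> alive s \<Longrightarrow> f s = 0"
    and f: "\<And>s. alive s \<Longrightarrow> ennreal (f s) \<le> 1 + (\<integral>\<^sup>+t. ennreal (f t) \<partial>step D s)"
    and pos: "\<And>s. 0 \<le> f s" and bdd: "\<And>s. f s \<le> C"
  shows "ennreal (f (Site x)) \<le> expected_absorption_time D x"
proof (cases "expected_absorption_time D x")
  case (real S)
  interpret prob_space "walk_law D x" by (rule prob_space_walk_law)
  let ?q = "\<lambda>n. \<integral>\<^sup>+\<omega>. survives n \<omega> \<partial>walk_law D x"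
  let ?a = "\<lambda>n. \<integral>\<^sup>+\<omega>. ennreal (f (\<omega> n)) * survives n \<omega> \<partial>walk_law D x"
  have C: "0 \<le> C" using pos bdd order_trans by blast
  have start: "ennreal (f (Site x)) = ?a 0"
  proof -
    have "?a 0 = (\<integral>\<^sup>+\<omega>. ennreal (f (Site x)) \<partial>walk_law D x)"
    proof (rule nn_integral_cong_AE)
      show "AE \<omega> in walk_law D x. ennreal (f (\<omega> 0)) * survives 0 \<omega> = ennreal (f (Site x))"
        using AE_walk_law_start by eventually_elim (auto simp: survives_def f0)
    qed
    then show ?thesis by (simp add: emeasure_space_1)
  qed
  have tele: "?a 0 \<le> (\<Sum>n<N. ?q n) + ?a N" for N
  proof (induction N)
    case (Suc N)
    have "?a N \<le> ?q N + ?a (Suc N)" by (rule nn_integral_survives_step) (use f0 f in auto)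
    then have "(\<Sum>n<N. ?q n) + ?a N \<le> (\<Sum>n<N. ?q n) + (?q N + ?a (Suc N))"
      by (rule add_left_mono)
    with Suc have "?a 0 \<le> (\<Sum>n<N. ?q n) + (?q N + ?a (Suc N))" by (rule order_trans)
    then show ?case by (simp only: sum.lessThan_Suc add.assoc)
  qed simp
  have last: "?a N \<le> ennreal C * ?q N" for N
  proof -
    have "?a N \<le> (\<integral>\<^sup>+\<omega>. ennreal C * survives N \<omega> \<partial>walk_law D x)"
      by (intro nn_integral_mono mult_right_mono ennreal_leI bdd) auto
    then show ?thesis
      by (simp add: nn_integral_cmult measurable_survives_walk_law)
  qed
  have sum_le: "(\<Sum>n<N. ?q n) \<le> ennreal S" for N
    using sum_survival_prob_le[where N=N and D=D and x=x] real by simp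
  have dec: "?q N \<le> ?q n" if "n \<le> N" for n N
    using that by (intro nn_integral_mono) (auto simp: survives_def)
  \<comment> \<open>Survival probabilities decrease and their sums stay below \<open>S\<close>, so
    the one at time \<open>N\<close> is at most \<open>S / real (Suc N)\<close>.\<close>
  have qN: "ennreal (real (Suc N)) * ?q N \<le> ennreal S" for N
  proof -
    have "(\<Sum>n<Suc N. ?q N) \<le> (\<Sum>n<Suc N. ?q n)" by (intro sum_mono dec) auto
    also have "\<dots> \<le> ennreal S" by (rule sum_le)
    finally show ?thesis by (simp add: ennreal_of_nat_eq_real_of_nat)
  qed
  have "f (Site x) \<le> S + C * (S / real (Suc N))" for N
  proof -
    have "?q N \<le> ennreal (S / real (Suc N))"
    proof -
      have "?q N = ennreal (1 / real (Suc N)) * (ennreal (real (Suc N)) * ?q N)"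
        by (simp add: mult.assoc[symmetric] ennreal_mult[symmetric] del: of_nat_Suc)
      also have "\<dots> \<le> ennreal (1 / real (Suc N)) * ennreal S"
        by (intro mult_left_mono qN) simp
      finally show ?thesis using real by (simp add: ennreal_mult[symmetric] del: of_nat_Suc)
    qed
    then have "?a N \<le> ennreal C * ennreal (S / real (Suc N))"
      using last[of N] by (meson mult_left_mono order_trans zero_le)
    then have "ennreal (f (Site x)) \<le> ennreal S + ennreal C * ennreal (S / real (Suc N))"
      unfolding start using tele[of N] add_mono[OF sum_le[of N]] order_trans by blast
    also have "\<dots> = ennreal (S + C * (S / real (Suc N)))"
      using real C by (simp add: ennreal_mult[symmetric] ennreal_plus[symmetric] del: ennreal_plus of_nat_Suc)
    finally show ?thesis
      using real C by (subst (asm) ennreal_le_iff) (simp_all add: add_nonneg_nonneg)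
  qed
  moreover have "(\<lambda>N. S + C * (S / real (Suc N))) \<longlonglongrightarrow> S + C * 0"
    by (intro tendsto_intros LIMSEQ_Suc[OF lim_const_over_n])
  ultimately have "f (Site x) \<le> S"
    by (intro LIMSEQ_le_const[where X="\<lambda>N. S + C * (S / real (Suc N))"]) auto
  then show ?thesis using real by (simp add: ennreal_leI)
qed simp

text \<open>Extending \<open>f\<close> by 0 to the sink, the last two hypotheses are the subsolution
  inequality with denominators cleared.\<close>

lemma expected_absorption_time_ge:
  fixes f :: "nat \<Rightarrow> real"
  assumes f0: "f 0 = 0" and pos: "\<And>k. 0 \<le> f k" and bdd: "\<And>k. f k \<le> C"
    and free: "\<And>k. Suc k \<notin> D \<Longrightarrow> 2 * f (Suc k) \<le> 2 + f k + f (k + 2)"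
    and trap: "\<And>k. Suc k \<in> D \<Longrightarrow> 3 * f (Suc k) \<le> 3 + f k + f (k + 2)"
  shows "ennreal (f x) \<le> expected_absorption_time D x"
proof -
  define F where "F s = (case s of Site k \<Rightarrow> f k | Sink \<Rightarrow> 0)" for s
  have F[simp]: "F (Site k) = f k" "F Sink = 0" for k by (simp_all add: F_def)
  have Fpos: "0 \<le> F s" for s by (cases s) (auto simp: pos)
  have C: "0 \<le> C" using pos bdd order_trans by blast
  have step: "ennreal (F s) \<le> 1 + (\<integral>\<^sup>+t. ennreal (F t) \<partial>step D s)" if s: "alive s" for s
  proof -
    obtain k where k: "s = Site (Suc k)" using s by (cases s) (auto simp: gr0_conv_Suc)
    have "F s \<le> 1 + measure_pmf.expectation (step D s) F"
      using free[of k] trap[of k] unfolding k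
      by (auto simp: integral_pmf_of_set field_simps)
    moreover have "ennreal (measure_pmf.expectation (step D s) F) = (\<integral>\<^sup>+t. ennreal (F t) \<partial>step D s)"
      by (intro nn_integral_eq_integral[symmetric] integrable_measure_pmf_finite)
        (auto simp: k Fpos)
    moreover have "0 \<le> measure_pmf.expectation (step D s) F" by (simp add: Fpos integral_nonneg_AE)
    ultimately show ?thesis
      by (metis ennreal_1 ennreal_leI ennreal_plus zero_le_one)
  qed
  have "F s \<le> C" for s by (cases s) (auto simp: bdd C)
  then have "ennreal (F (Site x)) \<le> expected_absorption_time D x"
    by (intro expected_absorption_time_ge_subsolution step Fpos) (auto simp: f0)
  then show ?thesis by simp
qed

section \<open>The harmonic function of the killed walk\<close>

text \<open>Harmonicity with value 0 at the sink, solved for the right neighbour: the two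
  neighbouring values add up to 2 or 3 times the middle one.\<close>

fun harm :: "nat set \<Rightarrow> nat \<Rightarrow> real" where
  "harm D 0 = 0"
| "harm D (Suc 0) = 1"
| "harm D (Suc (Suc k)) = (if Suc k \<in> D then 3 else 2) * harm D (Suc k) - harm D k"

text \<open>A trap raises the slope by the value there, so the slope never falls below 1 while the
  values stay nonnegative; hence one joint induction.\<close>

lemma harm_increment: "0 \<le> harm D k \<and> harm D k + 1 \<le> harm D (Suc k)"
  by (induction k) auto

lemma harm_nonneg: "0 \<le> harm D k"
  using harm_increment by blast

lemma harm_mono: "m \<le> n \<Longrightarrow> harm D m \<le> harm D n"
proof (rule lift_Suc_mono_le[of "harm D"])
  show "harm D k \<le> harm D (Suc k)" for k
    using harm_increment[of D k] by linarith
qed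

lemma harm_pos:
  assumes "0 < k"
  shows "0 < harm D k"
  using harm_mono[of 1 k D] assms by simp

section \<open>Growth of \<open>harm\<close> from trap to trap\<close>

lemma harm_affine_on_gap:
  assumes "\<And>k. m < k \<Longrightarrow> k < n \<Longrightarrow> k \<notin> D" and "m + j \<le> n"
  shows "harm D (m + j) = harm D m + real j * (harm D (Suc m) - harm D m)"
proof -
  have d: "harm D (Suc (m + i)) - harm D (m + i) = harm D (Suc m) - harm D m" if "m + i < n" for i
    using that
  proof (induction i)
    case (Suc i)
    then have "Suc (m + i) \<notin> D" using assms(1) by simp
    with Suc show ?case by simp
  qed simp
  show ?thesis using assms(2)
  proof (induction j)
    case (Suc j)
    then show ?case using d[of j] by (simp add: algebra_simps)
  qed simp
qed

text \<open>The new slope is the old one plus \<open>harm D n\<close>. The old slope is at most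
  \<open>harm D n / real (n - m)\<close>, since \<open>harm\<close> is affine from \<open>m\<close>
  to \<open>n\<close> and nonnegative at \<open>m\<close>.\<close>

lemma harm_slope_at_trap:
  assumes "m < n" and free: "\<And>k. m < k \<Longrightarrow> k < n \<Longrightarrow> k \<notin> D" and "n \<in> D"
  shows "harm D (Suc n) - harm D n \<le> harm D n * (1 + 1 / real (n - m))"
proof -
  define g where "g = n - m"
  obtain k where n: "n = Suc k" using \<open>m < n\<close> by (cases n) auto
  have g: "0 < g" and mg: "m + g = n" and mk: "m + (g - 1) = k"
    using \<open>m < n\<close> by (auto simp: g_def n)
  let ?d = "harm D (Suc m) - harm D m"
  have hn: "harm D n = harm D m + real g * ?d"
    using harm_affine_on_gap[of m n D g] free mg by simp
  have hk: "harm D k = harm D m + real (g - 1) * ?d"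
    using harm_affine_on_gap[of m n D "g - 1"] free mk n by simp
  have "harm D n - harm D k = ?d"
    unfolding hn hk using g by (simp add: algebra_simps of_nat_diff)
  moreover have "harm D (Suc n) = 3 * harm D n - harm D k"
    using \<open>n \<in> D\<close> by (simp add: n)
  moreover have "?d \<le> harm D n / real g"
    using hn g harm_nonneg[of D m] by (simp add: field_simps)
  ultimately show ?thesis by (simp add: g_def[symmetric] algebra_simps)
qed

lemma harm_next_trap_le:
  assumes "0 < n" "m < n" "n < l" and "n \<in> D"
    and "\<And>k. m < k \<Longrightarrow> k < n \<Longrightarrow> k \<notin> D" "\<And>k. n < k \<Longrightarrow> k < l \<Longrightarrow> k \<notin> D"
  shows "harm D l \<le> harm D n * real l * (1 + 1 / real (n - m))"
proof -
  let ?q = "1 + 1 / real (n - m)"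
  have q: "1 \<le> ?q" by simp
  have "harm D l = harm D n + real (l - n) * (harm D (Suc n) - harm D n)"
    using harm_affine_on_gap[of n l D "l - n"] assms by simp
  also have "\<dots> \<le> harm D n + real (l - n) * (harm D n * ?q)"
    using harm_slope_at_trap[of m n D] assms by (intro add_left_mono mult_left_mono) auto
  \<comment> \<open>The first term is inflated by the factors \<open>n\<close> and
    \<open>?q\<close>, both at least 1, so that the coefficients add up to \<open>l\<close>.\<close>
  also have "\<dots> \<le> real n * (harm D n * ?q) + real (l - n) * (harm D n * ?q)"
  proof -
    have "harm D n * 1 \<le> harm D n * ?q"
      by (rule mult_left_mono[OF q harm_nonneg])
    also have "\<dots> \<le> real n * (harm D n * ?q)"
      using mult_right_mono[of 1 "real n" "harm D n * ?q"] \<open>0 < n\<close> harm_nonneg[of D n] by simp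
    finally show ?thesis by simp
  qed
  also have "\<dots> = harm D n * real l * ?q"
  proof -
    have "real l = real n + real (l - n)" using \<open>n < l\<close> by simp
    then show ?thesis by (simp only: distrib_left distrib_right mult_ac)
  qed
  finally show ?thesis .
qed

text \<open>The subsolution is a multiple of \<^const>\<open>harm\<close> up to \<open>M\<close> and, on the gap, the expected exit time
  \<open>(N - k) (k - M)\<close> plus the affine term \<open>(N - k) / 3\<close>. With this term the inequality at the trap \<open>M\<close>
  reads \<open>N - M \<le> 3 + f (M - 1) + 4/3 (N - M - 1)\<close>.\<close>

lemma expected_absorption_time_ge_gap:
  assumes M: "0 < M" and MN: "M < N" and free: "\<And>k. M < k \<Longrightarrow> k < N \<Longrightarrow> k \<notin> D"
  shows "ennreal (real (N - M) / (3 * harm D M)) \<le> expected_absorption_time D 1"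
proof -
  \<comment> \<open>With this \<open>c\<close> both branches of \<open>f\<close> equal
    \<open>(N - M) / 3\<close> at \<open>M\<close>, and \<open>f 1 = c\<close> is the claimed bound
    because \<open>harm D 1 = 1\<close>.\<close>
  define c where "c = real (N - M) / (3 * harm D M)"
  define q where "q k = (real N - real k) * (real k - real M + 1/3)" for k
  define f where "f k = (if k \<le> M then c * harm D k else if k \<le> N then q k else 0)" for k
  have hM: "0 < harm D M" by (rule harm_pos[OF M])
  have c: "0 \<le> c" using hM by (simp add: c_def)
  have cM: "c * harm D M = (real N - real M) / 3"
    using hM MN by (simp add: c_def of_nat_diff)
  have low: "f k = c * harm D k" if "k \<le> M" for k using that by (simp add: f_def)
  \<comment> \<open>The branches overlap at \<open>M\<close> and at \<open>N\<close>, so near either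
    end each neighbour can be evaluated by whichever formula fits.\<close>
  have mid: "f k = q k" if "M \<le> k" "k \<le> N" for k
    using that cM by (cases "k = M") (auto simp: f_def q_def)
  have high: "f k = 0" if "N \<le> k" for k using that MN by (auto simp: f_def q_def)
  have pos: "0 \<le> f k" for k
    using c harm_nonneg[of D k] by (auto simp: f_def q_def)
  have bdd: "f k \<le> real N * (real N + 1)" for k
  proof -
    consider "k \<le> M" | "M \<le> k" "k \<le> N" | "N \<le> k" by linarith
    then show ?thesis
    proof cases
      case 1
      then have "f k \<le> c * harm D M" unfolding low[OF 1] by (intro mult_left_mono harm_mono c)
      also have "\<dots> \<le> real N * (real N + 1)" unfolding cM
        by (rule order_trans[of _ "real N * 1"]) (auto simp: algebra_simps)
      finally show ?thesis .
    next
      case 2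
      then show ?thesis unfolding mid[OF 2] q_def by (intro mult_mono) auto
    qed (simp add: high)
  qed
  have sub: "(Suc k \<notin> D \<longrightarrow> 2 * f (Suc k) \<le> 2 + f k + f (k + 2)) \<and>
      (Suc k \<in> D \<longrightarrow> 3 * f (Suc k) \<le> 3 + f k + f (k + 2))" for k
  proof -
    consider "Suc k < M" | "Suc k = M" | "M < Suc k" "Suc k < N" | "N \<le> Suc k" by linarith
    then show ?thesis
    proof cases
      case 1
      then show ?thesis by (auto simp: low algebra_simps)
    next
      case 2
      have "f (Suc k) = (real N - real M) / 3" using 2 cM by (simp add: low)
      moreover have "f (k + 2) = (real N - real M - 1) * (4/3)"
        using 2[symmetric] MN by (subst mid) (auto simp: q_def)
      moreover have "1 \<le> real N - real M" using MN by (simp add: Suc_leI le_diff_eq flip: of_nat_Suc)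
      ultimately show ?thesis using pos[of k] by auto
    next
      case 3
      \<comment> \<open>The quadratic \<open>q\<close> has constant second difference -2.\<close>
      have "2 * f (Suc k) = 2 + f k + f (k + 2)"
        using 3 by (subst (1 2 3) mid) (auto simp: q_def field_simps)
      with 3 free show ?thesis by auto
    next
      case 4
      then show ?thesis using pos[of k] pos[of "k + 2"] by (simp add: high)
    qed
  qed
  have "ennreal (f 1) \<le> expected_absorption_time D 1"
    by (rule expected_absorption_time_ge[OF _ pos bdd]) (use sub in \<open>auto simp: low\<close>)
  then show ?thesis using M by (simp add: low c_def)
qed

section \<open>Geometric growth of the lower bounds\<close>

theorem corollary2p13:
  fixes x :: "nat \<Rightarrow> nat"
  assumes "strict_mono x" and "0 < x 0"
    and "liminf (\<lambda>n. ereal (real (x (Suc n)) / (real (x n))\<^sup>2)) > 1"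
  shows "critical (range x)"
proof (rule ccontr)
  let ?D = "range x"
  let ?h = "\<lambda>n. harm ?D (x n)"
  assume "\<not> critical ?D"
  then obtain S where S: "expected_absorption_time ?D 1 = ennreal S" "0 \<le> S"
    unfolding critical_def by (cases "expected_absorption_time ?D 1") auto
  have xpos: "0 < x n" for n
    using assms(1,2) by (metis le0 less_le_trans strict_mono_less_eq)
  have xlt: "x n < x (Suc n)" for n
    using assms(1) by (simp add: strict_mono_less)
  have free: "k \<notin> ?D" if "x n < k" "k < x (Suc n)" for k n
    using that assms(1) by (auto simp: strict_mono_less)
  have hpos: "0 < ?h n" for n by (rule harm_pos[OF xpos])

  obtain a where a: "1 < ereal a"
    and lim: "ereal a < liminf (\<lambda>n. ereal (real (x (Suc n)) / (real (x n))\<^sup>2))"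
    using ereal_dense2[OF assms(3)] by blast
  \<comment> \<open>One factor \<open>b\<close> of \<open>a\<close> will absorb the slope error
    \<open>1 + 1 / gap\<close>; the other remains as growth rate.\<close>
  define b where "b = sqrt a"
  have b: "1 < b" and ab: "a = b * b" using a by (auto simp: b_def one_ereal_def)
  have "filterlim x at_top sequentially"
    using assms(1) by (rule filterlim_subseq)
  then have "filterlim (\<lambda>n. real (x n)) at_top sequentially"
    by (rule filterlim_compose[OF filterlim_real_sequentially])
  \<comment> \<open>The bound 2 makes consecutive traps at least double; \<open>1 / (b - 1)\<close>
    gives \<open>1 + 1 / x n \<le> b\<close>.\<close>
  then have "\<forall>\<^sub>F n in sequentially. max 2 (1 / (b - 1)) \<le> real (x n)"
    unfolding filterlim_at_top by blast
  with less_LiminfD[OF lim]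
  have "\<forall>\<^sub>F n in sequentially. a * (real (x n))\<^sup>2 \<le> real (x (Suc n)) \<and> 2 \<le> x n \<and> 1 + 1 / real (x n) \<le> b"
  proof eventually_elim
    case (elim n)
    then show ?case using b xpos[of n] by (auto simp: field_simps)
  qed
  then obtain n0 where n0: "a * (real (x n))\<^sup>2 \<le> real (x (Suc n))" "2 \<le> x n"
      "1 + 1 / real (x n) \<le> b" if "n0 \<le> n" for n
    by (auto simp: eventually_sequentially)

  have double: "2 * x n \<le> x (Suc n)" if "n0 \<le> n" for n
  proof -
    have "2 * real (x n) \<le> 1 * (real (x n))\<^sup>2"
      using n0(2)[OF that] by (simp add: power2_eq_square)
    also have "\<dots> \<le> a * (real (x n))\<^sup>2"
      using a by (intro mult_right_mono) (auto simp: one_ereal_def)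
    also have "\<dots> \<le> real (x (Suc n))" by (rule n0(1)[OF that])
    finally show ?thesis by linarith
  qed

  \<comment> \<open>Up to a factor 6, \<open>R n\<close> is the lower bound from the gap after
    \<open>x n\<close>: 3 comes from the gap lemma, 2 from replacing the gap by
    \<open>x (Suc n)\<close>.\<close>
  define R where "R n = real (x (Suc n)) / ?h n" for n
  have R_bound: "R n \<le> 6 * S" if "n0 \<le> n" for n
  proof -
    have "ennreal (real (x (Suc n) - x n) / (3 * ?h n)) \<le> ennreal S"
      using expected_absorption_time_ge_gap[OF xpos xlt free, of n] S by simp
    then have "real (x (Suc n) - x n) / (3 * ?h n) \<le> S"
      using S hpos[of n] by (simp add: ennreal_le_iff)
    then show ?thesis
      using double[OF that] hpos[of n] xlt[of n] by (simp add: R_def field_simps of_nat_diff)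
  qed
  \<comment> \<open>The index starts at \<open>Suc n\<close> because the slope estimate at a trap
    uses the length of the preceding gap, here the one from \<open>x n\<close>.\<close>
  have R_grow: "b * R (Suc n) \<le> R (Suc (Suc n))" if n: "n0 \<le> n" for n
  proof -
    let ?y = "real (x (Suc (Suc n)))"
    have y: "0 < ?y" using xpos by simp
    have "1 / real (x (Suc n) - x n) \<le> 1 / real (x n)"
      using double[OF n] xpos[of n] by (intro divide_left_mono) auto
    then have "1 + 1 / real (x (Suc n) - x n) \<le> b" using n0(3)[OF n] by (meson add_left_mono order_trans)
    then have "?h (Suc n) * ?y * (1 + 1 / real (x (Suc n) - x n)) \<le> ?h (Suc n) * ?y * b"
      using hpos[of "Suc n"] y by (intro mult_left_mono) auto
    moreover have "?h (Suc (Suc n)) \<le> ?h (Suc n) * ?y * (1 + 1 / real (x (Suc n) - x n))"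
      by (rule harm_next_trap_le) (use xpos xlt free in auto)
    ultimately have h: "?h (Suc (Suc n)) \<le> ?h (Suc n) * ?y * b" by (rule order_trans[rotated])
    \<comment> \<open>Expanding by \<open>b * ?y\<close> makes the bound \<open>h\<close> appear as
      denominator and \<open>a * ?y\<^sup>2\<close>, which is at most the next trap position, as
      numerator.\<close>
    have "b * R (Suc n) = a * ?y\<^sup>2 / (?h (Suc n) * ?y * b)"
      using b y hpos[of "Suc n"] by (simp add: R_def ab field_simps power2_eq_square)
    also have "\<dots> \<le> a * ?y\<^sup>2 / ?h (Suc (Suc n))"
      using h hpos b y ab by (intro divide_left_mono mult_pos_pos) auto
    also have "\<dots> \<le> R (Suc (Suc n))"
      unfolding R_def using n0(1)[of "Suc (Suc n)"] n hpos[of "Suc (Suc n)"] by (intro divide_right_mono) auto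
    finally show ?thesis .
  qed
  have "b ^ k * R (Suc n0) \<le> R (Suc n0 + k)" for k
  proof (induction k)
    case (Suc k)
    have "b * (b ^ k * R (Suc n0)) \<le> b * R (Suc (n0 + k))"
      using Suc b by (intro mult_left_mono) auto
    also have "\<dots> \<le> R (Suc (Suc (n0 + k)))" by (rule R_grow) simp
    finally show ?case by (simp add: mult.assoc)
  qed simp
  then have bdd: "b ^ k * R (Suc n0) \<le> 6 * S" for k
    by (rule order_trans[OF _ R_bound]) simp
  have Rpos: "0 < R (Suc n0)" using xpos hpos by (simp add: R_def)
  obtain k where "6 * S / R (Suc n0) < b ^ k" using real_arch_pow[OF b] by blast
  with bdd[of k] Rpos show False by (simp add: field_simps)
qed
end
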